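(* Let $\ell_n$ denote the $n$th lucky number. Then the inequality $$\ell_n > n \log n$$ holds for all integers $n \geq 1$; and the inequality $$\ell_n > n \big(\log n + \tfrac12(\log\log n)^2 - \log\log n - 7.207\big)$$ holds for all integers $n > \mathrm{e}^{\mathrm{e}^{4.927}}$.
   Context: $\log$ is the natural logarithm and $\mathrm{e}$ is its base. Lucky numbers: let $\mathcal{L}_1$ be the set of all positive integers and let $\mathcal{L}_2$ be the set consisting of the number $2$ and all odd integers $\geq 3$. For every integer $m \geq 1$ let $(\ell_{m,n})_{n \geq 1}$ be the elements of $\mathcal{L}_m$ listed in increasing order. For every integer $m \geq 2$, recursively, $\mathcal{L}_{m+1}$ is the set of all $\ell_{m,n}$ such that $n$ is a positive integer not divisible by $\ell_{m,m}$. The lucky numbers are $\ell_1 := 2$ (by convention) and $\ell_n := \ell_{n,n}$ for every integer $n \geq 2$ (so $\ell_2 = 3$, $\ell_3 = 7$, $\ell_4 = 9$, $\ell_5 = 13$, ...). *)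

theory Defs
  imports Complex_Main "HOL-Library.Infinite_Set"
begin

text \<open>The \<open>n\<close>-th element, counted from 1, of an infinite set of naturals in increasing order;
  the library's \<^const>\<open>enumerate\<close> counts from 0. It is only used for \<open>n \<ge> 1\<close>.\<close>

definition nth_elem :: "nat set \<Rightarrow> nat \<Rightarrow> nat" where
  "nth_elem S n = enumerate S (n - 1)"

text \<open>The stages are indexed from 1; the value at index 0 is a dummy.\<close>

fun lucky_sieve :: "nat \<Rightarrow> nat set" where
  "lucky_sieve 0 = UNIV"
| "lucky_sieve (Suc 0) = {k. k \<ge> 1}"
| "lucky_sieve (Suc (Suc 0)) = {2} \<union> {k. odd k \<and> k \<ge> 3}"
| "lucky_sieve (Suc (Suc (Suc i))) =
     (let m = Suc (Suc i) in
       {nth_elem (lucky_sieve m) n | n. n \<ge> 1 \<and> \<not> nth_elem (lucky_sieve m) m dvd n})"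

definition lucky :: "nat \<Rightarrow> nat" where
  "lucky n = (if n = 1 then 2 else nth_elem (lucky_sieve n) n)"

text \<open>All stages are infinite, so \<^const>\<open>enumerate\<close> is meaningful on each of them.\<close>

lemma lucky_sieve_ge_2_infinite:
  "infinite (lucky_sieve (Suc (Suc i))) \<and> (\<forall>k \<in> lucky_sieve (Suc (Suc i)). k \<ge> 2)"
proof (induction i)
  case 0
  have "infinite {k::nat. odd k \<and> k \<ge> 3}"
    unfolding infinite_nat_iff_unbounded
  proof
    fix m :: nat
    have "2 * m + 3 > m \<and> 2 * m + 3 \<in> {k::nat. odd k \<and> k \<ge> 3}" by simp
    then show "\<exists>n>m. n \<in> {k::nat. odd k \<and> k \<ge> 3}" by blast
  qed
  then show ?case by auto
next
  case (Suc i)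
  define S where "S = lucky_sieve (Suc (Suc i))"
  define d where "d = nth_elem S (Suc (Suc i))"
  have inf: "infinite S" and ge: "\<And>k. k \<in> S \<Longrightarrow> k \<ge> 2"
    using Suc by (auto simp: S_def)
  have mem: "nth_elem S n \<in> S" for n
    using inf by (simp add: nth_elem_def enumerate_in_set)
  have d: "d \<ge> 2" using ge mem by (simp add: d_def)
  define N where "N = {n. n \<ge> 1 \<and> \<not> d dvd n}"
  have eq: "lucky_sieve (Suc (Suc (Suc i))) = nth_elem S ` N"
    by (auto simp: S_def d_def N_def Let_def)
  have "infinite N"
    unfolding infinite_nat_iff_unbounded
  proof
    fix m :: nat
    have "\<not> d dvd d * m + 1"
      using d dvd_add_right_iff[of d "d * m" 1] by simp
    moreover have "d * m + 1 > m" using d by (cases d) auto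
    ultimately show "\<exists>n>m. n \<in> N" unfolding N_def by force
  qed
  moreover have "inj_on (nth_elem S) N"
  proof (rule inj_onI)
    fix a b assume "a \<in> N" "b \<in> N" "nth_elem S a = nth_elem S b"
    moreover from this have "a - 1 = b - 1"
      using strict_mono_eq[OF strict_mono_enumerate[OF inf]] by (simp add: nth_elem_def)
    ultimately show "a = b" by (auto simp: N_def)
  qed
  ultimately have "infinite (nth_elem S ` N)" by (simp add: finite_image_iff)
  then show ?case using eq mem ge by auto
qed

lemma infinite_lucky_sieve: "infinite (lucky_sieve m)"
proof -
  have "infinite {k::nat. k \<ge> 1}"
    using infinite_Ici[of "1::nat"] by (simp add: atLeast_def)
  then show ?thesis
    using lucky_sieve_ge_2_infinite by (cases m rule: lucky_sieve.cases) (auto simp del: lucky_sieve.simps(3,4))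
qed

end

theory Submission
  imports Defs "HOL-Analysis.Harmonic_Numbers" "HOL-Analysis.Complex_Transcendental"
begin

text \<open>
  Undoing the sieving steps one by one, an element of index \<open>k\<close> after the deletion of every
  \<open>d\<close>-th element had the index \<open>k + (k - 1) div (d - 1)\<close> before. Bounding the quotient from both
  sides relates \<open>\<ell>\<^sub>n\<close> to the product \<open>R m = (\<Prod>j\<le>m. \<ell>\<^sub>j / (\<ell>\<^sub>j - 1))\<close>: on the one hand
  \<open>\<ell>\<^sub>n - 1 \<le> (n - 1) R m\<close> where \<open>m\<close> is the number of lucky numbers up to \<open>n\<close>, on the other hand
  \<open>\<ell>\<^sub>n - 1 \<ge> (n - M) R M\<close> for every \<open>M < n\<close>. The first bound gives
  \<open>R n - R (n - 1) \<ge> (R (n - 1) / R m) / (n - 1)\<close>, hence \<open>R n \<ge> ln n + c\<close>. If \<open>\<ell>\<^sub>n > n ln n\<close>, then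
  moreover \<open>R (n - 1) / R m \<ge> 1 + ln (ln m) / R m\<close>, and upper bounds of \<open>R m\<close> make \<open>R n\<close> exceed
  \<open>ln n\<close> by a multiple of \<open>(ln (ln n))\<^sup>2\<close>: the crude bound \<open>R m \<le> 2 ln m\<close> gives the factor \<open>1/4\<close>,
  which suffices for an inductive proof of \<open>\<ell>\<^sub>n > n ln n\<close>; the asymptotically sharp bound
  \<open>R m \<le> ln m + (ln (ln m))\<^sup>2 + 8.5\<close> gives the factor \<open>1/2\<close>. Both results follow
  from the lower bound for \<open>\<ell>\<^sub>n\<close> with \<open>M\<close> close to \<open>n / ln n\<close>.
\<close>

section \<open>Tracing the sieve\<close>

text \<open>Each value is forced to be the least element of the common range not listed before. This
  identifies \<open>enumerate\<close> of a sieve stage with an explicit function.\<close>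

lemma strict_mono_range_unique:
  fixes f g :: "nat \<Rightarrow> nat"
  assumes "strict_mono f" "strict_mono g" "range f = range g"
  shows "f = g"
proof
  fix n show "f n = g n"
  proof (induction n rule: less_induct)
    case (less n)
    have aux: "g' n \<le> f' n"
      if f': "strict_mono f'" and g': "strict_mono g'" and rng: "range f' = range g'"
        and eq: "\<And>i. i < n \<Longrightarrow> f' i = g' i"
      for f' g' :: "nat \<Rightarrow> nat"
    proof -
      have "f' n \<in> range g'" unfolding rng[symmetric] by (rule rangeI)
      then obtain j where j: "f' n = g' j" by (rule rangeE)
      have "\<not> j < n"
      proof
        assume "j < n"
        then have "f' j < f' n" using f' by (simp add: strict_mono_less)
        then show False using eq[OF \<open>j < n\<close>] j by simp
      qed
      then show ?thesis using j g' by (simp add: strict_mono_less_eq)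
    qed
    show ?case
      by (rule order_antisym; rule aux) (use assms less in simp_all)
  qed
qed

text \<open>Counting from 0, the \<open>i\<close>-th element that survives the deletion of every \<open>(c+1)\<close>-st
  element of a sequence had the index \<open>skip c i\<close> before.\<close>

definition skip :: "nat \<Rightarrow> nat \<Rightarrow> nat" where
  "skip c i = i + i div c"

lemma strict_mono_skip: "strict_mono (skip c)"
  by (rule strict_monoI) (simp add: skip_def add_less_le_mono div_le_mono)

lemma le_skip: "i \<le> skip c i"
  by (simp add: skip_def)

lemma skip_small: "i < c \<Longrightarrow> skip c i = i"
  by (simp add: skip_def)

text \<open>If \<open>i = c * q + r\<close> with \<open>r < c\<close>, then
  \<open>skip c i = Suc c * q + r\<close>. So exactly the indices with remainder \<open>c\<close>
  modulo \<open>Suc c\<close> are missed, and counted from 0 these are the deleted ones.\<close>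

lemma range_skip:
  assumes "c \<ge> 1"
  shows "range (skip c) = {j. \<not> Suc c dvd Suc j}"
proof (intro set_eqI iffI)
  fix j assume "j \<in> range (skip c)"
  then obtain i where "j = i + i div c" by (auto simp: skip_def)
  moreover have "i = c * (i div c) + i mod c" by simp
  ultimately have "Suc j = Suc c * (i div c) + Suc (i mod c)" unfolding mult_Suc by linarith
  then have "Suc c dvd Suc j \<longleftrightarrow> Suc c dvd Suc (i mod c)"
    by (simp only: dvd_add_right_iff[OF dvd_triv_left])
  moreover have "\<not> Suc c dvd Suc (i mod c)"
    using assms by (intro nat_dvd_not_less) auto
  ultimately show "j \<in> {j. \<not> Suc c dvd Suc j}" by simp
next
  fix j assume "j \<in> {j. \<not> Suc c dvd Suc j}"
  then have nd: "\<not> Suc c dvd Suc j" by simp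
  define q r where "q = j div Suc c" and "r = j mod Suc c"
  have j: "j = q * Suc c + r" unfolding q_def r_def by (rule div_mult_mod_eq[symmetric])
  have "r \<noteq> c"
  proof
    assume "r = c"
    then have "Suc j = Suc q * Suc c" using j by simp
    then have "Suc c dvd Suc j" by (metis dvd_triv_right)
    then show False using nd by blast
  qed
  moreover have "r < Suc c" by (simp add: r_def)
  ultimately have "r < c" by simp
  then have "skip c (q * c + r) = j" using j assms by (simp add: skip_def)
  then show "j \<in> range (skip c)" by (metis rangeI)
qed

lemma lucky_eq_nth_elem: "n \<ge> 2 \<Longrightarrow> lucky n = nth_elem (lucky_sieve n) n"
  by (simp add: lucky_def)

lemma lucky_ge_2: "lucky n \<ge> 2" if "n \<ge> 1"
proof (cases "n = 1")
  case False
  with that have "2 \<le> n" by simp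
  then obtain i where n: "n = Suc (Suc i)" by (auto dest!: le_Suc_ex simp: numeral_2_eq_2)
  then show ?thesis
    using lucky_sieve_ge_2_infinite[of i] lucky_eq_nth_elem[of n]
    by (simp add: nth_elem_def enumerate_in_set del: lucky_sieve.simps)
qed (simp add: lucky_def)

lemma enumerate_lucky_sieve_1: "enumerate (lucky_sieve (Suc 0)) = Suc"
proof (rule strict_mono_range_unique)
  show "strict_mono (enumerate (lucky_sieve (Suc 0)))"
    by (rule strict_mono_enumerate[OF infinite_lucky_sieve])
  have "range Suc = {k. k \<ge> 1}" by (auto simp: image_iff Suc_le_eq gr0_conv_Suc)
  then show "range (enumerate (lucky_sieve (Suc 0))) = range Suc"
    using range_enumerate[OF infinite_lucky_sieve[of "Suc 0"]] by simp
qed (simp add: strict_mono_def)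

lemma enumerate_lucky_sieve_2:
  "enumerate (lucky_sieve (Suc (Suc 0))) = (\<lambda>i. if i = 0 then 2 else 2 * i + 1)" (is "_ = ?f")
proof (rule strict_mono_range_unique)
  show "strict_mono (enumerate (lucky_sieve (Suc (Suc 0))))"
    by (rule strict_mono_enumerate[OF infinite_lucky_sieve])
  have "range ?f = {2} \<union> {k. odd k \<and> k \<ge> 3}"
  proof (intro set_eqI iffI)
    fix k assume "k \<in> {2} \<union> {k::nat. odd k \<and> k \<ge> 3}"
    then have "k = ?f (if k = 2 then 0 else k div 2)" by auto
    then show "k \<in> range ?f" by blast
  qed (auto split: if_splits)
  then show "range (enumerate (lucky_sieve (Suc (Suc 0)))) = range ?f"
    using range_enumerate[OF infinite_lucky_sieve[of "Suc (Suc 0)"]] by simp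
qed (auto simp: strict_mono_def)

lemma enumerate_lucky_sieve_Suc:
  assumes "m \<ge> 2"
  shows "enumerate (lucky_sieve (Suc m)) i = enumerate (lucky_sieve m) (skip (lucky m - 1) i)"
proof -
  obtain k where m: "m = Suc (Suc k)" using assms by (auto dest!: le_Suc_ex simp: numeral_2_eq_2)
  define S c where "S = lucky_sieve m" and "c = lucky m - 1"
  have c: "c \<ge> 1" "Suc c = lucky m" using lucky_ge_2[of m] assms by (auto simp: c_def)
  have inf: "infinite S" by (simp add: S_def infinite_lucky_sieve)
  have "lucky_sieve (Suc m) = {nth_elem S n | n. n \<ge> 1 \<and> \<not> Suc c dvd n}"
    using c(2) lucky_eq_nth_elem[OF assms] by (simp add: m S_def Let_def)
  also have "\<dots> = enumerate S ` {j. \<not> Suc c dvd Suc j}"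
  proof (intro set_eqI iffI)
    fix x assume "x \<in> {nth_elem S n | n. n \<ge> 1 \<and> \<not> Suc c dvd n}"
    then obtain n where "x = nth_elem S n" "n \<ge> 1" "\<not> Suc c dvd n" by blast
    then show "x \<in> enumerate S ` {j. \<not> Suc c dvd Suc j}"
      by (intro image_eqI[of _ _ "n - 1"]) (simp_all add: nth_elem_def)
  next
    fix x assume "x \<in> enumerate S ` {j. \<not> Suc c dvd Suc j}"
    then obtain j where "x = enumerate S j" "\<not> Suc c dvd Suc j" by blast
    then show "x \<in> {nth_elem S n | n. n \<ge> 1 \<and> \<not> Suc c dvd n}"
      by (intro CollectI exI[of _ "Suc j"]) (simp add: nth_elem_def)
  qed
  also have "\<dots> = range (\<lambda>i. enumerate S (skip c i))"
    by (simp add: range_skip[OF c(1), symmetric] image_image)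
  finally have sieve: "lucky_sieve (Suc m) = range (\<lambda>i. enumerate S (skip c i))" .
  have "enumerate (lucky_sieve (Suc m)) = (\<lambda>i. enumerate S (skip c i))"
  proof (intro strict_mono_range_unique)
    show "strict_mono (enumerate (lucky_sieve (Suc m)))"
      by (rule strict_mono_enumerate[OF infinite_lucky_sieve])
    show "strict_mono (\<lambda>i. enumerate S (skip c i))"
      using strict_mono_o[OF strict_mono_enumerate[OF inf] strict_mono_skip[of c]]
      by (simp add: o_def)
    show "range (enumerate (lucky_sieve (Suc m))) = range (\<lambda>i. enumerate S (skip c i))"
      using sieve range_enumerate[OF infinite_lucky_sieve[of "Suc m"]] by (simp only:)
  qed
  then show ?thesis by (simp add: S_def c_def)
qed

text \<open>\<open>trace m i\<close> is the index before the first sieving step of the element that has index \<open>i\<close>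
  after the \<open>m\<close>-th step, all indices counted from 0.\<close>

fun trace :: "nat \<Rightarrow> nat \<Rightarrow> nat" where
  "trace 0 i = i"
| "trace (Suc m) i = trace m (skip (lucky (Suc m) - 1) i)"

text \<open>The convention \<open>lucky 1 = 2\<close> makes the passage to the odd numbers an
  ordinary sieving step with \<open>skip 1 i = 2 * i\<close>. Index 0 is exceptional: there the
  trace gives 1, while the stages from the second on start with 2.\<close>

lemma enumerate_lucky_sieve:
  assumes "i \<ge> 1"
  shows "enumerate (lucky_sieve (Suc m)) i = Suc (trace m i)"
  using assms
proof (induction m arbitrary: i)
  case 0
  then show ?case by (simp only: enumerate_lucky_sieve_1 trace.simps)
next
  case (Suc m)
  show ?case
  proof (cases "m = 0")
    case True
    then show ?thesis
      using Suc.prems by (simp only: enumerate_lucky_sieve_2) (simp add: skip_def lucky_def)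
  next
    case False
    then have "enumerate (lucky_sieve (Suc (Suc m))) i
        = enumerate (lucky_sieve (Suc m)) (skip (lucky (Suc m) - 1) i)"
      by (intro enumerate_lucky_sieve_Suc) simp
    then show ?thesis
      using Suc.IH[of "skip (lucky (Suc m) - 1) i"] Suc.prems le_skip[of i "lucky (Suc m) - 1"]
      by simp
  qed
qed

lemma lucky_trace:
  assumes "n \<ge> 2"
  shows "lucky n = Suc (trace (n - 1) (n - 1))"
  using enumerate_lucky_sieve[of "n - 1" "n - 1"] assms lucky_eq_nth_elem[OF assms]
  by (simp add: nth_elem_def)

lemma strict_mono_trace: "strict_mono (trace m)"
proof (induction m)
  case (Suc m)
  have "trace (Suc m) = trace m \<circ> skip (lucky (Suc m) - 1)" by (rule ext) simp
  then show ?case using strict_mono_o[OF Suc strict_mono_skip] by metis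
qed (simp add: strict_mono_def)

lemma trace_mono_stage: "m \<le> m' \<Longrightarrow> trace m i \<le> trace m' i"
proof (induction rule: dec_induct)
  case (step k)
  then show ?case
    using strict_mono_trace[of k] le_skip[of i "lucky (Suc k) - 1"]
    using le_trans[OF step.IH] by (simp add: strict_mono_less_eq)
qed simp

text \<open>A step with \<open>Suc i < lucky j\<close> makes its first deletion beyond index
  \<open>i\<close>, so \<open>skip\<close> leaves \<open>i\<close> fixed.\<close>

lemma trace_eq_of_large:
  assumes "m \<le> m'" "\<And>j. m < j \<Longrightarrow> j \<le> m' \<Longrightarrow> Suc i < lucky j"
  shows "trace m' i = trace m i"
  using assms
proof (induction rule: dec_induct)
  case (step k)
  then have "skip (lucky (Suc k) - 1) i = i" by (intro skip_small) (auto simp: less_diff_conv)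
  then show ?case using step by simp
qed simp

section \<open>Monotonicity of the lucky numbers\<close>

lemma lucky_1 [simp]: "lucky (Suc 0) = 2"
  by (simp add: lucky_def)

lemma lucky_2 [simp]: "lucky 2 = 3"
  using lucky_trace[of 2] by (simp add: numeral_2_eq_2 lucky_1 skip_def)

lemma lucky_less_Suc:
  assumes "n \<ge> 1"
  shows "lucky n < lucky (Suc n)"
proof (cases "n = 1")
  case True
  then show ?thesis using lucky_1 lucky_2 by (simp add: numeral_2_eq_2)
next
  case False
  have "trace (n - 1) (n - 1) < trace (n - 1) n"
    using assms by (simp add: strict_mono_less[OF strict_mono_trace])
  also have "\<dots> \<le> trace n n" by (rule trace_mono_stage) simp
  finally show ?thesis using lucky_trace[of n] lucky_trace[of "Suc n"] False assms by simp
qed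

lemma lucky_strict_mono: "1 \<le> m \<Longrightarrow> m < n \<Longrightarrow> lucky m < lucky n"
  by (induction n) (auto simp: less_Suc_eq intro: lucky_less_Suc less_trans[OF _ lucky_less_Suc])

lemma less_lucky: "n \<ge> 1 \<Longrightarrow> n < lucky n"
  by (induction n rule: nat_induct_at_least) (use lucky_1 lucky_less_Suc in \<open>force+\<close>)

text \<open>Here \<open>m\<close> counts the lucky numbers up to \<open>n\<close>, that is, the
  sieving steps that can move index \<open>n - 1\<close>.\<close>

lemma last_lucky_le:
  assumes "n \<ge> 2"
  obtains m where "1 \<le> m" "m < n" "lucky m \<le> n" "\<And>j. m < j \<Longrightarrow> n < lucky j"
proof -
  define A where "A = {j. 1 \<le> j \<and> lucky j \<le> n}"
  have A: "A \<subseteq> {..<n}" using less_lucky by (auto simp: A_def intro: less_le_trans)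
  then have fin: "finite A" by (rule finite_subset) simp
  have "1 \<in> A" using assms by (simp add: A_def lucky_1)
  then have ne: "A \<noteq> {}" by auto
  show thesis
  proof (rule that)
    show "1 \<le> Max A" "Max A < n" "lucky (Max A) \<le> n" using Max_in[OF fin ne] A by (auto simp: A_def)
    show "n < lucky j" if "Max A < j" for j
    proof (rule ccontr)
      assume "\<not> n < lucky j"
      then have "j \<in> A" using that by (simp add: A_def)
      then show False using Max_ge[OF fin] that by force
    qed
  qed
qed

section \<open>The product \<open>R\<close> and two-sided bounds for traces\<close>

definition R :: "nat \<Rightarrow> real" where
  "R m = (\<Prod>j=1..m. real (lucky j) / (real (lucky j) - 1))"

lemma R_0: "R 0 = 1" by (simp add: R_def)

lemma R_Suc: "R (Suc m) = R m * (real (lucky (Suc m)) / (real (lucky (Suc m)) - 1))"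
  by (simp add: R_def)

lemma R_Suc_add: "R (Suc m) = R m + R m / (real (lucky (Suc m)) - 1)"
proof -
  have "real (lucky (Suc m)) - 1 > 0" using lucky_ge_2[of "Suc m"] by simp
  then show ?thesis unfolding R_Suc by (simp add: field_simps)
qed

lemma R_pos: "R m > 0"
proof (induction m)
  case (Suc m)
  have "real (lucky (Suc m)) - 1 > 0" using lucky_ge_2[of "Suc m"] by simp
  then show ?case using Suc unfolding R_Suc_add by (simp add: add_pos_pos)
qed (simp add: R_0)

lemma R_mono: "m \<le> n \<Longrightarrow> R m \<le> R n"
proof (induction rule: dec_induct)
  case (step k)
  have "real (lucky (Suc k)) - 1 > 0" using lucky_ge_2[of "Suc k"] by simp
  then show ?case using step R_pos[of k] unfolding R_Suc_add by (intro add_increasing2) simp_all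
qed simp

lemma R_1: "R (Suc 0) = 2"
  by (simp add: R_def lucky_1)

text \<open>Without the floor in \<open>skip\<close>, undoing step \<open>j\<close> multiplies the
  index by \<open>lucky j / (lucky j - 1)\<close>.\<close>

lemma trace_le: "real (trace m i) \<le> real i * R m"
proof (induction m arbitrary: i)
  case (Suc m)
  define c where "c = lucky (Suc m) - 1"
  have c: "real c = real (lucky (Suc m)) - 1" "real c > 0"
    using lucky_ge_2[of "Suc m"] by (auto simp: c_def of_nat_diff)
  have "real (i div c) \<le> real i / real c" by (simp add: of_nat_div_le_of_nat)
  moreover have "real (lucky (Suc m)) / real c = 1 + 1 / real c"
    using c by (simp add: field_simps)
  ultimately have "real (skip c i) \<le> real i * (real (lucky (Suc m)) / real c)"
    by (simp add: skip_def distrib_left)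
  then have "real (skip c i) * R m \<le> real i * (real (lucky (Suc m)) / real c) * R m"
    using R_pos[of m] by (intro mult_right_mono) auto
  then show ?case using Suc[of "skip c i"] c by (simp add: c_def R_Suc mult_ac)
qed (simp add: R_0)

text \<open>For indices shifted by 1 the floor satisfies
  \<open>i div c + 1 \<ge> (i + 1) / c\<close>, so undoing step \<open>j + 1\<close> loses at most
  1. The \<open>j\<close> earlier steps, undone afterwards, magnify this loss by
  \<open>R j\<close>.\<close>

lemma trace_ge: "real (trace m i) + 1 \<ge> (real i + 1) * R m - (\<Sum>j<m. R j)"
proof (induction m arbitrary: i)
  case (Suc m)
  define c where "c = lucky (Suc m) - 1"
  have c: "real c = real (lucky (Suc m)) - 1" "real c > 0" "c \<ge> 1"
    using lucky_ge_2[of "Suc m"] by (auto simp: c_def of_nat_diff)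
  have "i < c * (i div c) + c"
    using mult_div_mod_eq[of c i] mod_less_divisor[of c i] c(3) by linarith
  then have "i + 1 \<le> c * (i div c) + c" by simp
  then have "real i + 1 \<le> real c * real (i div c) + real c"
    by (metis of_nat_1 of_nat_add of_nat_le_iff of_nat_mult)
  then have "(real i + 1) / real c \<le> real (i div c) + 1"
    using c(2) by (simp add: field_simps)
  moreover have "real (lucky (Suc m)) / real c = 1 + 1 / real c"
    using c by (simp add: field_simps)
  ultimately have "real (skip c i) + 1 \<ge> (real i + 1) * (real (lucky (Suc m)) / real c) - 1"
    by (simp add: skip_def distrib_left add_divide_distrib)
  then have "(real (skip c i) + 1) * R m \<ge> ((real i + 1) * (real (lucky (Suc m)) / real c) - 1) * R m"
    using R_pos[of m] by (intro mult_right_mono) auto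
  then show ?case using Suc[of "skip c i"] c by (simp add: c_def R_Suc algebra_simps)
qed (simp add: R_0)

lemma lucky_ge_linear:
  assumes "n \<ge> 2" "M < n"
  shows "real (lucky n) \<ge> real n * R M - (\<Sum>j<M. R j)"
proof -
  have "trace M (n - 1) \<le> trace (n - 1) (n - 1)" using assms by (intro trace_mono_stage) simp
  then show ?thesis
    using trace_ge[of "n - 1" M] lucky_trace[OF assms(1)] assms by (simp add: of_nat_diff)
qed

text \<open>Puts the accumulated rounding loss into closed form. The extra 1 is absorbed because
  \<open>R 0 = 1\<close> and \<open>R M \<ge> 2\<close>.\<close>

lemma sum_R_le:
  assumes "M \<ge> 1"
  shows "(\<Sum>j<M. R j) + 1 \<le> real M * R M"
proof -
  obtain k where k: "M = Suc k" using assms by (cases M) auto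
  have "(\<Sum>j<M. R j) = 1 + (\<Sum>j<k. R (Suc j))"
    unfolding k sum.lessThan_Suc_shift by (simp add: R_0)
  also have "(\<Sum>j<k. R (Suc j)) \<le> (\<Sum>j<k. R M)"
    by (rule sum_mono) (use k in \<open>auto intro!: R_mono\<close>)
  also have "\<dots> = (real M - 1) * R M" by (simp add: k)
  finally have "(\<Sum>j<M. R j) \<le> 1 + (real M - 1) * R M" by simp
  moreover have "R M \<ge> 2" using R_mono[OF assms] R_1 by simp
  ultimately show ?thesis by (simp add: algebra_simps)
qed

lemma lucky_ge_product:
  assumes "1 \<le> M" "M < n"
  shows "real (lucky n) - 1 \<ge> (real n - real M) * R M"
  using lucky_ge_linear[of n M] sum_R_le[OF assms(1)] assms by (simp add: algebra_simps)

lemma lucky_le_product: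
  assumes "n \<ge> 2" "m < n" "\<And>j. m < j \<Longrightarrow> n < lucky j"
  shows "real (lucky n) - 1 \<le> (real n - 1) * R m"
proof -
  have "trace (n - 1) (n - 1) = trace m (n - 1)"
    using assms by (intro trace_eq_of_large) auto
  then show ?thesis
    using trace_le[of m "n - 1"] lucky_trace[OF assms(1)] assms by (simp add: of_nat_diff)
qed

section \<open>The first lucky numbers\<close>

lemma trace_numeral [simp]:
  "trace (numeral k) i = trace (pred_numeral k) (skip (lucky (numeral k) - 1) i)"
  by (simp add: numeral_eq_Suc)

lemma lucky_by_trace:
  assumes "n \<ge> 2" "m < n" "n < lucky (Suc m)"
  shows "lucky n = Suc (trace m (n - 1))"
proof -
  have "n < lucky j" if "m < j" for j
    using that assms(3) lucky_strict_mono[of "Suc m" j] by (cases "j = Suc m") auto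
  then have "trace (n - 1) (n - 1) = trace m (n - 1)"
    using assms by (intro trace_eq_of_large) auto
  then show ?thesis using lucky_trace[OF assms(1)] by simp
qed

lemma lucky_3 [simp]: "lucky 3 = 7"
  using lucky_trace[of 3] by (simp add: skip_def)

lemma lucky_4 [simp]: "lucky 4 = 9"
  using lucky_trace[of 4] by (simp add: skip_def)

lemma lucky_5 [simp]: "lucky 5 = 13"
  using lucky_trace[of 5] by (simp add: skip_def)

lemma lucky_6 [simp]: "lucky 6 = 15"
  using lucky_trace[of 6] by (simp add: skip_def)

lemma lucky_7 [simp]: "lucky 7 = 21"
  using lucky_trace[of 7] by (simp add: skip_def)

lemma lucky_8 [simp]: "lucky 8 = 25"
  using lucky_trace[of 8] by (simp add: skip_def)

lemma lucky_9 [simp]: "lucky 9 = 31"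
  using lucky_trace[of 9] by (simp add: skip_def)

lemma lucky_10 [simp]: "lucky 10 = 33"
  using lucky_trace[of 10] by (simp add: skip_def)

lemma lucky_11 [simp]: "lucky 11 = 37"
  using lucky_trace[of 11] by (simp add: skip_def)

lemma lucky_12 [simp]: "lucky 12 = 43"
  using lucky_trace[of 12] by (simp add: skip_def)

lemma lucky_13 [simp]: "lucky 13 = 49"
  using lucky_trace[of 13] by (simp add: skip_def)

lemma lucky_14 [simp]: "lucky 14 = 51"
  using lucky_trace[of 14] by (simp add: skip_def)

lemma lucky_15 [simp]: "lucky 15 = 63"
  using lucky_trace[of 15] by (simp add: skip_def)

lemma lucky_16 [simp]: "lucky 16 = 67"
  using lucky_trace[of 16] by (simp add: skip_def)

lemma lucky_17_upto_64:
  "lucky 17 = 69 \<and> lucky 18 = 73 \<and> lucky 19 = 75 \<and> lucky 20 = 79 \<and> lucky 21 = 87 \<and>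
   lucky 22 = 93 \<and> lucky 23 = 99 \<and> lucky 24 = 105 \<and> lucky 25 = 111 \<and> lucky 26 = 115 \<and>
   lucky 27 = 127 \<and> lucky 28 = 129 \<and> lucky 29 = 133 \<and> lucky 30 = 135 \<and> lucky 31 = 141 \<and>
   lucky 32 = 151 \<and> lucky 33 = 159 \<and> lucky 34 = 163 \<and> lucky 35 = 169 \<and> lucky 36 = 171 \<and>
   lucky 37 = 189 \<and> lucky 38 = 193 \<and> lucky 39 = 195 \<and> lucky 40 = 201 \<and> lucky 41 = 205 \<and>
   lucky 42 = 211 \<and> lucky 43 = 219 \<and> lucky 44 = 223 \<and> lucky 45 = 231 \<and> lucky 46 = 235 \<and>
   lucky 47 = 237 \<and> lucky 48 = 241 \<and> lucky 49 = 259 \<and> lucky 50 = 261 \<and> lucky 51 = 267 \<and>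
   lucky 52 = 273 \<and> lucky 53 = 283 \<and> lucky 54 = 285 \<and> lucky 55 = 289 \<and> lucky 56 = 297 \<and>
   lucky 57 = 303 \<and> lucky 58 = 307 \<and> lucky 59 = 319 \<and> lucky 60 = 321 \<and> lucky 61 = 327 \<and>
   lucky 62 = 331 \<and> lucky 63 = 339 \<and> lucky 64 = 349"
proof -
  \<comment> \<open>Since \<open>lucky 16 = 67\<close>, fifteen steps determine every lucky number
    of index below 67.\<close>
  have rule: "lucky n = Suc (trace 15 (n - 1))" if "15 < n" "n < 67" for n
    using that by (intro lucky_by_trace) (simp_all add: lucky_16)
  show ?thesis
    by (intro conjI; subst rule; simp add: skip_def)
qed

lemma R_numeral:
  "R (numeral k)
    = R (pred_numeral k) * (real (lucky (numeral k)) / (real (lucky (numeral k)) - 1))"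
  by (simp add: numeral_eq_Suc R_Suc)

text \<open>The values at 15, 27 and 48 serve the verification for \<open>n\<close> from 65 to 512;
  those at 64 start the inductions that bound \<open>R\<close>.\<close>

lemma R_15: "5.93 \<le> R 15"
  and R_27: "6.8 \<le> R 27"
  and R_48: "7.64 \<le> R 48"
  and R_64: "8.07 \<le> R 64" "R 64 \<le> 8.08"
  by (simp_all add: R_numeral R_1 lucky_17_upto_64)

lemma sum_R_15: "(\<Sum>j<15. R j) \<le> 65.3"
  and sum_R_27: "(\<Sum>j<27. R j) \<le> 141.7"
  and sum_R_48: "(\<Sum>j<48. R j) \<le> 293.9"
  by (simp_all add: R_numeral R_1 R_0 lucky_17_upto_64 lessThan_nat_numeral)

section \<open>Growth of the product\<close>

lemma ln_2_ge: "ln (2::real) \<ge> 307/443"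
  using ln_approx_bounds[of 2 3] by (simp add: eval_nat_numeral)

lemma ln_le_of_le_power_2:
  assumes "0 < x" "x \<le> 2 ^ k"
  shows "ln (x::real) \<le> 25/36 * real k"
proof -
  have "ln x \<le> ln (2 ^ k)" using assms by simp
  also have "\<dots> = real k * ln 2" by (rule ln_realpow)
  also have "\<dots> \<le> real k * (25/36)" by (intro mult_left_mono ln2_le_25_over_36) simp
  finally show ?thesis by simp
qed

lemma ln_ge_of_power_2_le:
  assumes "2 ^ k \<le> x"
  shows "ln (x::real) \<ge> 307/443 * real k"
proof -
  have "0 < x" using assms by (rule less_le_trans[rotated]) simp
  have "real k * (307/443) \<le> real k * ln 2" by (intro mult_left_mono ln_2_ge) simp
  also have "\<dots> = ln (2 ^ k)" by (rule ln_realpow[symmetric])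
  also have "\<dots> \<le> ln x" using assms \<open>0 < x\<close> by simp
  finally show ?thesis by simp
qed

lemma exp_1_le_ln:
  assumes "64 \<le> x"
  shows "exp 1 \<le> ln (x::real)"
  using ln_ge_of_power_2_le[of 6 x] e_less_272 assms by simp

lemma ln_le_div_e:
  assumes "0 < x"
  shows "ln (x::real) \<le> x / exp 1"
  using ln_le_minus_one[of "x / exp 1"] assms by (simp add: ln_div)

lemma exp_1_ge: "exp 1 \<ge> (2.7::real)"
proof -
  have "(1 + 1/6 + (1/6)\<^sup>2 / 2) ^ 6 \<le> exp (1/6::real) ^ 6"
    by (intro power_mono exp_lower_Taylor_quadratic) simp_all
  also have "\<dots> = exp 1" by (simp flip: exp_of_nat_mult)
  finally show ?thesis by (simp add: power2_eq_square eval_nat_numeral)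
qed

section \<open>Increments of the product\<close>

lemma R_Suc_ge:
  assumes "k \<ge> 1" "m \<le> k" "\<And>j. m < j \<Longrightarrow> Suc k < lucky j"
  shows "R (Suc k) - R k \<ge> R k / R m / real k"
proof -
  have pos: "real (lucky (Suc k)) - 1 > 0" using lucky_ge_2[of "Suc k"] by simp
  have "real (lucky (Suc k)) - 1 \<le> real k * R m"
    using lucky_le_product[of "Suc k" m] assms by simp
  then have "R k / (real k * R m) \<le> R k / (real (lucky (Suc k)) - 1)"
    using pos R_pos[of k] by (intro divide_left_mono) (auto intro: less_le_trans)
  then show ?thesis by (simp add: R_Suc_add mult.commute)
qed

lemma R_Suc_ge_inverse:
  assumes "k \<ge> 1"
  shows "R (Suc k) - R k \<ge> 1 / real k"
proof -
  obtain m where m: "m < Suc k" "\<And>j. m < j \<Longrightarrow> Suc k < lucky j"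
    using last_lucky_le[of "Suc k"] assms by auto
  have "1 \<le> R k / R m" using R_mono[of m k] R_pos[of m] m(1) by simp
  then have "1 / real k \<le> R k / R m / real k" by (intro divide_right_mono) auto
  then show ?thesis using R_Suc_ge[of k m] assms m by fastforce
qed

lemma R_diff_ge_ln:
  assumes "1 \<le> m" "m \<le> n"
  shows "R n - R m \<ge> ln (real n) - ln (real m)"
  using assms(2)
proof (induction rule: dec_induct)
  case (step k)
  have "ln (real (Suc k)) - ln (real k) \<le> (real (Suc k) - real k) / real k"
    using assms step by (intro ln_diff_le) auto
  then show ?case using step R_Suc_ge_inverse[of k] assms by auto
qed simp

text \<open>The \<open>- 1\<close> yields the strict inequality for \<open>lucky n\<close> and
  matches the product bounds, which concern \<open>lucky n - 1\<close>.\<close>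

definition dominant :: "nat \<Rightarrow> bool" where
  "dominant n \<longleftrightarrow> real n * ln (real n) \<le> real (lucky n) - 1"

text \<open>Dominance makes \<open>R m / ln m\<close> nonincreasing: at \<open>x = k + 1\<close> the
  factor of growth is at most \<open>1 + 1 / (x * ln x)\<close>, and
  \<open>ln k * (1 + 1 / (x * ln x)) \<le> ln k + 1 / x \<le> ln x\<close>.\<close>

lemma R_ratio_le:
  assumes "2 \<le> M" "M \<le> m" "\<And>j. M < j \<Longrightarrow> j \<le> m \<Longrightarrow> dominant j"
  shows "R m \<le> R M / ln (real M) * ln (real m)"
  using assms(2,3)
proof (induction rule: dec_induct)
  case (step k)
  define x where "x = real (Suc k)"
  have k: "real k \<ge> 2" "x = real k + 1" using step assms(1) by (auto simp: x_def)
  then have lnk: "ln (real k) > 0" "ln x > 0" "ln (real k) \<le> ln x" by auto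
  have "x * ln x \<le> real (lucky (Suc k)) - 1"
    using step.prems[of "Suc k"] step.hyps by (simp add: dominant_def x_def)
  moreover have "real (lucky (Suc k)) - 1 > 0" using lucky_ge_2[of "Suc k"] by simp
  moreover have "x * ln x > 0" using k lnk by simp
  ultimately have "R (Suc k) \<le> R k + R k / (x * ln x)"
    unfolding R_Suc_add using R_pos[of k] mult_pos_pos[of "x * ln x" "real (lucky (Suc k)) - 1"]
    by (intro add_left_mono divide_left_mono) (simp_all add: mult.commute)
  also have "\<dots> = R k * (1 + 1 / (x * ln x))" by (simp add: field_simps)
  also have "\<dots> \<le> R M / ln (real M) * ln (real k) * (1 + 1 / (x * ln x))"
    using step k lnk by (intro mult_right_mono) auto
  also have "\<dots> = R M / ln (real M) * (ln (real k) + ln (real k) / ln x / x)"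
    by (simp add: distrib_left)
  also have "\<dots> \<le> R M / ln (real M) * ln x"
  proof (rule mult_left_mono)
    have "ln (real k) - ln x \<le> (real k - x) / x" using k by (intro ln_diff_le) auto
    also have "\<dots> = - 1 / x" using k by simp
    finally have "ln (real k) + 1 / x \<le> ln x" by simp
    moreover have "ln (real k) / ln x / x \<le> 1 / x" using k lnk by (intro divide_right_mono) auto
    ultimately show "ln (real k) + ln (real k) / ln x / x \<le> ln x" by linarith
    show "0 \<le> R M / ln (real M)" using R_pos[of M] assms(1) by (intro divide_nonneg_nonneg) auto
  qed
  finally show ?case by (simp add: x_def)
qed (use assms in auto)

lemma R_le_2_ln:
  assumes "64 \<le> m" "\<And>j. 64 < j \<Longrightarrow> j \<le> m \<Longrightarrow> dominant j"
  shows "R m \<le> 2 * ln (real m)"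
proof -
  \<comment> \<open>The ratio \<open>R 64 / ln 64\<close> is at most
    \<open>8.08 / 4.04 = 2\<close>.\<close>
  have ln64: "ln (64::real) \<ge> 4.04" using ln_ge_of_power_2_le[of 6 64] by simp
  then have "R 64 / ln 64 \<le> 2" using R_64 by (simp add: divide_le_eq)
  then have "R 64 / ln 64 * ln (real m) \<le> 2 * ln (real m)"
    using assms(1) by (intro mult_right_mono) auto
  then show ?thesis using R_ratio_le[of 64 m] assms by simp
qed

text \<open>The induction step shared by both lower bounds for \<open>R\<close>. Dominance of
  \<open>m\<close> gives \<open>m * ln m \<le> lucky m - 1 \<le> k\<close>, so
  \<open>R k - R m \<ge> ln k - ln m \<ge> ln (ln m)\<close>, and the increment of \<open>R\<close>
  is at least \<open>(1 + ln (ln m) / R m) / k\<close>.\<close>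

lemma R_gain:
  fixes F F' :: "real \<Rightarrow> real"
  assumes "64 \<le> m" "m \<le> k" "lucky m \<le> Suc k" "dominant m"
    and "\<And>j. m < j \<Longrightarrow> Suc k < lucky j"
    and deriv: "\<And>x. real k \<le> x \<Longrightarrow> (F has_real_derivative F' x) (at x)"
    and bound: "\<And>x. real k < x \<Longrightarrow> x * F' x \<le> ln (ln (real m)) / R m"
  shows "R (Suc k) - R k \<ge> (ln (real (Suc k)) + F (Suc k)) - (ln (real k) + F k)"
proof -
  define u where "u = ln (real m)"
  have kpos: "real k > 0" "real m > 0" using assms by auto
  have u: "u \<ge> exp 1" unfolding u_def using assms(1) by (intro exp_1_le_ln) simp
  have u1: "u > 1" using u exp_1_ge by simp
  have "real m * u \<le> real k"
    using assms(3,4) by (simp add: dominant_def u_def)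
  then have "ln (real m * u) \<le> ln (real k)" using u1 kpos by (subst ln_le_cancel_iff) auto
  moreover have "ln (real m * u) = ln (real m) + ln u" using u1 kpos by (intro ln_mult_pos) simp_all
  ultimately have "ln u \<le> ln (real k) - ln (real m)" by (simp add: u_def)
  then have "R m + ln u \<le> R k" using R_diff_ge_ln[of m k] assms by simp
  then have "(R m + ln u) / R m \<le> R k / R m" using R_pos[of m] by (intro divide_right_mono) auto
  then have "1 + ln u / R m \<le> R k / R m" using R_pos[of m] by (simp add: add_divide_distrib)
  then have "(1 + ln u / R m) / real k \<le> R k / R m / real k" by (intro divide_right_mono) auto
  also have "\<dots> \<le> R (Suc k) - R k" using assms by (intro R_Suc_ge) auto
  finally have inc: "(1 + ln u / R m) / real k \<le> R (Suc k) - R k" .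
  \<comment> \<open>By the mean value theorem the increment of \<open>ln + F\<close> is
    \<open>(1 + z * F' z) / z\<close> for some \<open>z > k\<close>, where \<open>bound\<close>
    applies.\<close>
  have "\<exists>z>real k. z < real (Suc k) \<and>
      (ln (real (Suc k)) + F (Suc k)) - (ln (real k) + F k) = (real (Suc k) - real k) * (1 / z + F' z)"
    using kpos by (intro MVT2) (auto intro!: derivative_eq_intros deriv simp: divide_inverse)
  then obtain z where z: "z > real k"
    "(ln (real (Suc k)) + F (Suc k)) - (ln (real k) + F k) = 1 / z + F' z" by auto
  have "1 / z + F' z = (1 + z * F' z) / z" using z kpos by (simp add: field_simps)
  also have "\<dots> \<le> (1 + ln u / R m) / z"
    using bound[OF z(1)] z kpos by (intro divide_right_mono) (auto simp: u_def)
  also have "\<dots> \<le> (1 + ln u / R m) / real k"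
    using z kpos u1 R_pos[of m] by (intro divide_left_mono) (auto intro!: add_nonneg_nonneg divide_nonneg_pos)
  finally show ?thesis using inc z by simp
qed

lemma R_ge_quarter_upto_512:
  assumes "64 \<le> n" "n \<le> 512"
  shows "R n \<ge> ln (real n) + 2.9 + (ln (ln (real n)))\<^sup>2 / 4"
proof -
  have "ln (real n) \<le> 6.25" using ln_le_of_le_power_2[of "real n" 9] assms by simp
  moreover have "ln (real n) > 1" using exp_1_le_ln[of "real n"] exp_1_ge assms by simp
  ultimately have "ln (ln (real n)) \<le> ln (4 * 1.5625)" "0 \<le> ln (ln (real n))" by simp_all
  moreover have "ln (4 * 1.5625::real) \<le> 1.96"
    using ln_le_of_le_power_2[of 4 2] ln_le_minus_one[of "1.5625"] by (subst ln_mult_pos) simp_all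
  ultimately have "(ln (ln (real n)))\<^sup>2 \<le> 1.96\<^sup>2" by (intro power_mono) auto
  \<comment> \<open>The surplus \<open>R 64 - ln 64 \<ge> 8.07 - 25/6 > 3.9\<close> covers
    \<open>2.9 + 1.96\<^sup>2 / 4 < 3.87\<close>.\<close>
  moreover have "R 64 + ln (real n) - ln 64 \<le> R n" using R_diff_ge_ln[of 64 n] assms by simp
  moreover have "ln (64::real) \<le> 25/6" using ln_le_of_le_power_2[of 64 6] by simp
  ultimately show ?thesis using R_64 by (simp add: power2_eq_square)
qed

lemma R_ge_quarter:
  assumes "64 \<le> n" "\<And>j. 64 \<le> j \<Longrightarrow> j \<le> n \<Longrightarrow> dominant j"
  shows "R n \<ge> ln (real n) + 2.9 + (ln (ln (real n)))\<^sup>2 / 4"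
  using assms
proof (induction rule: dec_induct)
  case base
  show ?case by (rule R_ge_quarter_upto_512) simp_all
next
  case (step k)
  show ?case
  \<comment> \<open>As \<open>lucky 64 = 349\<close>, the index \<open>m\<close> below is at least
    64 from here on.\<close>
  proof (cases "Suc k < 350")
    case True
    then show ?thesis using step by (intro R_ge_quarter_upto_512) simp_all
  next
    case False
    obtain m where m: "1 \<le> m" "m < Suc k" "lucky m \<le> Suc k" "\<And>j. m < j \<Longrightarrow> Suc k < lucky j"
      using last_lucky_le[of "Suc k"] step by auto
    have "m \<ge> 64"
    proof (rule ccontr)
      assume "\<not> 64 \<le> m"
      then show False using m(4)[of 64] False by (simp add: lucky_17_upto_64)
    qed
    define u where "u = ln (real m)"
    have u: "u \<ge> exp 1" unfolding u_def using \<open>m \<ge> 64\<close> by (intro exp_1_le_ln) simp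
    have u1: "u > 1" using u exp_1_ge by simp
    have "(ln (real (Suc k)) + (ln (ln (real (Suc k))))\<^sup>2 / 4) - (ln (real k) + (ln (ln (real k)))\<^sup>2 / 4)
      \<le> R (Suc k) - R k"
    proof (rule R_gain)
      show "dominant m" using step m \<open>m \<ge> 64\<close> by auto
      fix x assume x: "real k \<le> x"
      then have "x \<ge> 64" using step by linarith
      then have "ln x > 1" using exp_1_le_ln[of x] exp_1_ge by linarith
      then show "((\<lambda>x. (ln (ln x))\<^sup>2 / 4) has_real_derivative (ln (ln x) / (2 * ln x) / x)) (at x)"
        using \<open>x \<ge> 64\<close> by (auto intro!: derivative_eq_intros simp: field_simps)
    next
      fix x assume x: "real k < x"
      then have xm: "x \<ge> real m" "x > 0" using m by auto
      then have ux: "u \<le> ln x" using \<open>m \<ge> 64\<close> by (simp add: u_def)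
      have "R m \<le> 2 * u" unfolding u_def using \<open>m \<ge> 64\<close> m step by (intro R_le_2_ln) auto
      have "x * (ln (ln x) / (2 * ln x) / x) = ln (ln x) / ln x / 2" using xm by simp
      \<comment> \<open>The function \<open>ln v / v\<close> decreases for \<open>v \<ge> e\<close>,
        and \<open>u = ln m \<le> ln x\<close>.\<close>
      also have "\<dots> \<le> ln u / u / 2"
        using ln_x_over_x_mono[OF u ux] by (intro divide_right_mono) auto
      also have "\<dots> = ln u / (2 * u)" by simp
      also have "\<dots> \<le> ln u / R m"
        using \<open>R m \<le> 2 * u\<close> R_pos[of m] u1 by (intro divide_left_mono) auto
      finally show "x * (ln (ln x) / (2 * ln x) / x) \<le> ln (ln (real m)) / R m" by (simp add: u_def)
    qed (use m \<open>m \<ge> 64\<close> in auto)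
    moreover have "ln (real k) + 2.9 + (ln (ln (real k)))\<^sup>2 / 4 \<le> R k" using step by auto
    ultimately show ?thesis by linarith
  qed
qed

section \<open>The first-order bound\<close>

lemma dominant_upto_64:
  assumes "1 \<le> n" "n \<le> 64"
  shows "dominant n"
proof -
  \<comment> \<open>On a dyadic block \<open>ln n \<le> 25/36 * k\<close>, which reduces the claim
    to a finite check in integers.\<close>
  have range: "dominant n" if "1 \<le> a" "a \<le> n" "n < b" "b \<le> Suc (2 ^ k)"
    "\<forall>i\<in>set [a..<b]. 25 * k * i \<le> 36 * (lucky i - 1)" for a b k
  proof -
    have n: "n \<ge> 1" "n \<le> 2 ^ k" using that by linarith+
    have "25 * k * n \<le> 36 * (lucky n - 1)" using that by simp
    then have le: "25 * real k * real n \<le> 36 * real (lucky n - 1)"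
      by (metis of_nat_le_iff of_nat_mult of_nat_numeral)
    have "real n \<le> 2 ^ k" using n(2) by (metis of_nat_le_iff of_nat_numeral of_nat_power)
    then have "ln (real n) \<le> 25/36 * real k" using n(1) by (intro ln_le_of_le_power_2) auto
    then have "real n * ln (real n) \<le> real n * (25/36 * real k)" by (intro mult_left_mono) auto
    also have "\<dots> \<le> real (lucky n - 1)" using le by (simp add: field_simps)
    finally show ?thesis using lucky_ge_2[OF n(1)] by (simp add: dominant_def of_nat_diff)
  qed
  consider "n = 1" | "n = 2" | "3 \<le> n" "n < 5" | "5 \<le> n" "n < 9" | "9 \<le> n" "n < 17"
    | "17 \<le> n" "n < 33" | "33 \<le> n" "n < 65"
    using assms by linarith
  then show ?thesis
  proof cases
    case 1 then show ?thesis by (intro range[of 1 2 0]) (simp_all add: lucky_17_upto_64)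
  next
    case 2 then show ?thesis by (intro range[of 2 3 1]) (simp_all add: lucky_17_upto_64)
  next
    case 3 then show ?thesis by (intro range[of 3 5 2]) (simp_all add: lucky_17_upto_64)
  next
    case 4 then show ?thesis by (intro range[of 5 9 3]) (simp_all add: lucky_17_upto_64)
  next
    case 5 then show ?thesis by (intro range[of 9 17 4]) (simp_all add: lucky_17_upto_64)
  next
    case 6 then show ?thesis by (intro range[of 17 33 5]) (simp_all add: lucky_17_upto_64)
  next
    case 7 then show ?thesis by (intro range[of 33 65 6]) (simp_all add: lucky_17_upto_64)
  qed
qed

text \<open>With \<open>ln n\<close> replaced by \<open>25/36 * k\<close>, the difference of the two
  sides is linear in \<open>n\<close> with nonnegative slope, so the left end \<open>a\<close> of
  the block decides.\<close>

lemma dominant_by_linear_bound: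
  assumes "M < n" "2 \<le> n" "a \<le> n" "n \<le> 2 ^ k" "r \<le> R M" "(\<Sum>j<M. R j) \<le> s"
    "25/36 * real k \<le> r" "(r - 25/36 * real k) * real a \<ge> s + 1"
  shows "dominant n"
proof -
  have "real n \<le> 2 ^ k" using assms(4) by (metis of_nat_le_iff of_nat_numeral of_nat_power)
  then have "ln (real n) \<le> 25/36 * real k" using assms(2) by (intro ln_le_of_le_power_2) auto
  then have "real n * ln (real n) \<le> real n * (25/36 * real k)" by (intro mult_left_mono) auto
  moreover have "(r - 25/36 * real k) * real a \<le> (r - 25/36 * real k) * real n"
    using assms by (intro mult_left_mono) auto
  moreover have "real n * r \<le> real n * R M" using assms by (intro mult_left_mono) auto
  moreover have "(r - 25/36 * real k) * real n = real n * r - real n * (25/36 * real k)"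
    by (simp add: algebra_simps)
  ultimately show ?thesis
    using lucky_ge_linear[of n M] assms unfolding dominant_def by linarith
qed

lemma dominant_upto_512:
  assumes "1 \<le> n" "n \<le> 512"
  shows "dominant n"
proof -
  consider "n \<le> 64" | "65 \<le> n" "n \<le> 128" | "129 \<le> n" "n \<le> 256" | "257 \<le> n" using assms by linarith
  then show ?thesis
  proof cases
    case 2
    then show ?thesis using R_15 sum_R_15
      by (intro dominant_by_linear_bound[of 15 n 65 7 "5.93" "65.3"]) simp_all
  next
    case 3
    then show ?thesis using R_27 sum_R_27
      by (intro dominant_by_linear_bound[of 27 n 129 8 "6.8" "141.7"]) simp_all
  next
    case 4
    then show ?thesis using R_48 sum_R_48 assms
      by (intro dominant_by_linear_bound[of 48 n 257 9 "7.64" "293.9"]) simp_all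
  qed (use dominant_upto_64 assms in simp)
qed

section \<open>The induction step beyond 512\<close>

lemma gt_512_of_ln_ge_7:
  assumes "7 \<le> ln (real n)"
  shows "512 < n"
proof (rule ccontr)
  assume "\<not> 512 < n"
  then have "n = 0 \<or> ln (real n) \<le> 25/36 * real 9"
    using ln_le_of_le_power_2[of "real n" 9] by force
  then show False using assms by auto
qed

lemma ln_le_div_64:
  assumes "512 \<le> x"
  shows "ln (x::real) \<le> x / 64"
proof -
  have "ln 512 \<le> (6.25::real)" using ln_le_of_le_power_2[of 512 9] by simp
  moreover have "ln x - ln 512 \<le> (x - 512) / 512" using assms by (intro ln_diff_le) auto
  ultimately show ?thesis using assms by (simp add: field_simps)
qed

lemma ln_le_div_2_7:
  assumes "0 < x"
  shows "ln (x::real) \<le> x / 2.7"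
proof -
  have "x / exp 1 \<le> x / 2.7" using exp_1_ge assms by (intro divide_left_mono) auto
  then show ?thesis using ln_le_div_e[OF assms] by linarith
qed

text \<open>The parameter \<open>M\<close> is \<open>n / ln n\<close>, rounded up.\<close>

lemma lucky_ge_div_ln:
  assumes "512 \<le> n"
  obtains M where "64 \<le> M" "M < n" "ln (real M) \<ge> ln (real n) - ln (ln (real n))"
    "real (lucky n) - 1 \<ge> (real n - real n / ln (real n) - 1) * R M"
proof -
  define x L where "x = real n" and "L = ln x"
  have x: "x \<ge> 512" using assms by (simp add: x_def)
  have L: "L \<ge> 6" using ln_ge_of_power_2_le[of 9 x] x by (simp add: L_def)
  have xL: "L \<le> x / 64" unfolding L_def using x by (rule ln_le_div_64)
  define M where "M = nat \<lceil>x / L\<rceil>"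
  have xL0: "x / L > 0" using x L by simp
  then have M: "real M \<ge> x / L" "real M \<le> x / L + 1" unfolding M_def by linarith+
  have xL64: "x / L \<ge> 64" using xL L by (simp add: field_simps)
  have "x / L \<le> x / 6" using L x by (intro divide_left_mono) auto
  then have "real M < x" using M x by linarith
  then have Mn: "M < n" by (simp add: x_def)
  have "64 \<le> M" using xL64 M by linarith
  moreover have "ln (real M) \<ge> L - ln L"
  proof -
    have "ln (x / L) \<le> ln (real M)" using M xL0 by (subst ln_le_cancel_iff) auto
    then show ?thesis using x L by (simp add: ln_div L_def)
  qed
  moreover have "real (lucky n) - 1 \<ge> (x - x / L - 1) * R M"
  proof -
    have "(x - x / L - 1) * R M \<le> (x - real M) * R M"
      using M R_pos[of M] by (intro mult_right_mono) auto
    then show ?thesis using lucky_ge_product[of M n] Mn \<open>64 \<le> M\<close> by (simp add: x_def)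
  qed
  ultimately show thesis using that[of M] Mn M by (simp add: x_def L_def)
qed

text \<open>Passing from \<open>n\<close> to \<open>M\<close> costs up to
  \<open>y = ln (ln n)\<close> in \<open>ln M\<close>; the quarter square in
  \<open>R_ge_quarter\<close> recovers this loss.\<close>

lemma dominant_step:
  assumes "512 \<le> n" "\<And>j. 64 \<le> j \<Longrightarrow> j < n \<Longrightarrow> dominant j"
  shows "dominant n"
proof -
  define x L y where "x = real n" and "L = ln x" and "y = ln L"
  obtain M where M: "64 \<le> M" "M < n" "ln (real M) \<ge> L - y"
    "real (lucky n) - 1 \<ge> (x - x / L - 1) * R M"
    using lucky_ge_div_ln[OF assms(1)] by (auto simp: x_def L_def y_def)
  have x: "x \<ge> 512" using assms by (simp add: x_def)
  have L: "L \<ge> 6" using ln_ge_of_power_2_le[of 9 x] x by (simp add: L_def)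
  have xL: "L \<le> x / 64" unfolding L_def using x by (rule ln_le_div_64)
  have y: "y \<ge> 1" using ln_ge_of_power_2_le[of 2 L] L by (simp add: y_def)
  have "y \<le> L / 2.7" unfolding y_def using L by (intro ln_le_div_2_7) simp
  then have yL: "L - y \<ge> L * (17/27)" by (simp add: field_simps)
  \<comment> \<open>Together with \<open>L - y \<ge> 17/27 * L\<close> this gives
    \<open>ln (L - y) \<ge> y - 1/2\<close>.\<close>
  have "exp (- (1/2)) \<le> (17/27::real)"
  proof -
    have "exp (1/2) \<ge> (1 + 1/2 + (1/2)\<^sup>2 / 2 :: real)" by (intro exp_lower_Taylor_quadratic) simp
    then have "inverse (exp (1/2)) \<le> inverse (1 + 1/2 + (1/2)\<^sup>2 / 2 :: real)"
      by (intro le_imp_inverse_le) (simp_all add: power2_eq_square)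
    then show ?thesis by (simp add: exp_minus power2_eq_square)
  qed
  then have "L * exp (- (1/2)) \<le> L - y" using yL L mult_left_mono[of "exp (- (1/2))" "17/27" L] by linarith
  then have "ln (L * exp (- (1/2))) \<le> ln (L - y)" using L yL by (subst ln_le_cancel_iff) (auto intro: less_le_trans)
  then have "y - 1/2 \<le> ln (L - y)" using L by (simp add: ln_mult y_def)
  also have "\<dots> \<le> ln (ln (real M))" using M L yL by (subst ln_le_cancel_iff) auto
  finally have "(y - 1/2)\<^sup>2 \<le> (ln (ln (real M)))\<^sup>2" using y by (intro power_mono) auto
  moreover have "ln (real M) + 2.9 + (ln (ln (real M)))\<^sup>2 / 4 \<le> R M"
    using M assms by (intro R_ge_quarter) auto
  \<comment> \<open>Completing the square extracts a full \<open>y\<close>, leaving the surplus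
    \<open>2.9 - 1.5 = 1.4\<close> over \<open>L\<close>.\<close>
  moreover have "(y - 1/2)\<^sup>2 / 4 = (y - 5/2)\<^sup>2 / 4 + y - 1.5"
    by (simp add: power2_eq_square field_simps)
  ultimately have R: "L + 1.4 \<le> R M" using M zero_le_power2[of "y - 5/2"] by linarith
  have "x / L \<le> x / 6" using L x by (intro divide_left_mono) auto
  then have pos: "x - x / L - 1 \<ge> 0" using x by linarith
  have "x * L \<le> (x - x / L - 1) * (L + 1.4)"
  proof -
    have "(x - x / L - 1) * (L + 1.4) = x * L + 0.4 * x - 1.4 * (x / L) - L - 1.4"
      using L by (simp add: field_simps)
    moreover have "0 \<le> 0.4 * x - 1.4 * (x / L) - L - 1.4"
      using \<open>x / L \<le> x / 6\<close> xL x by linarith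
    ultimately show ?thesis by simp
  qed
  also have "\<dots> \<le> (x - x / L - 1) * R M" using R pos by (intro mult_left_mono)
  finally show ?thesis using M by (simp add: dominant_def x_def L_def)
qed

lemma dominant:
  assumes "1 \<le> n"
  shows "dominant n"
  using assms
proof (induction n rule: less_induct)
  case (less n)
  then show ?case using dominant_upto_512[of n] dominant_step[of n] by (cases "n \<le> 512") auto
qed

section \<open>An upper bound for the product\<close>

lemma R_le_two_ln:
  assumes "64 \<le> m"
  shows "R m \<le> 2 * ln (real m)"
  using assms by (intro R_le_2_ln dominant) auto

text \<open>With \<open>z = ln (ln n) / ln n\<close>, \<open>R_ratio_le\<close> gives
  \<open>R k \<le> R M / (1 - z)\<close>, and the lower bound for \<open>lucky n\<close> contributes
  the factor \<open>x * (1 - w) * R M\<close>, so the increment is at most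
  \<open>1 / ((1 - z) * (1 - w) * x)\<close>.\<close>

lemma R_Suc_le:
  assumes "16 \<le> ln (real (Suc k))"
  shows "R (Suc k) - R k \<le> (1 + 2 * (ln (ln (real (Suc k))) / ln (real (Suc k)))) / real (Suc k)"
proof -
  define n x L y z where "n = Suc k" and "x = real n" and "L = ln x" and "y = ln L" and "z = y / L"
  have L: "L \<ge> 16" using assms by (simp add: n_def x_def L_def)
  have n: "n \<ge> 512" using gt_512_of_ln_ge_7[of n] L by (simp add: L_def x_def)
  then have x: "x \<ge> 512" by (simp add: x_def)
  obtain M where M: "64 \<le> M" "M < n" "ln (real M) \<ge> L - y"
    "real (lucky n) - 1 \<ge> (x - x / L - 1) * R M"
    using lucky_ge_div_ln[OF n] by (auto simp: x_def L_def y_def)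
  have y: "y \<ge> 2.7" using ln_ge_of_power_2_le[of 4 L] L by (simp add: y_def)
  have "exp 1 \<le> (16::real)" using e_less_272 by simp
  then have "z \<le> ln 16 / 16" using ln_x_over_x_mono[of 16 L] L by (simp add: z_def y_def)
  also have "ln 16 / 16 \<le> (1/4::real)" using ln_le_of_le_power_2[of 16 4] by simp
  finally have z: "z \<le> 1/4" "z > 0" using y L by (simp_all add: z_def)
  define w where "w = 1 / L + 1 / x"
  have "1 / x \<le> 1 / (64 * L)" using ln_le_div_64[OF x] x L by (intro divide_left_mono) (auto simp: L_def)
  also have "\<dots> = 1 / L / 64" by simp
  finally have "w \<le> 65 / 64 * (1 / L)" by (simp add: w_def)
  also have "\<dots> \<le> 0.4 * z" using y L by (simp add: z_def field_simps)
  finally have w: "w \<le> 0.4 * z" .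
  \<comment> \<open>This is where \<open>z \<le> 1/4\<close> enters: it makes
    \<open>0.6 - 2.4 * z\<close> nonnegative.\<close>
  have "1 \<le> 1 + z * (0.6 - 2.4 * z)" using z by (auto intro: mult_nonneg_nonneg)
  also have "\<dots> \<le> 1 + z * (0.6 - 2.4 * z) + 0.8 * z ^ 3" using z by simp
  also have "\<dots> = (1 - z) * (1 - 0.4 * z) * (1 + 2 * z)"
    by (simp add: power3_eq_cube field_simps)
  also have "\<dots> \<le> (1 - z) * (1 - w) * (1 + 2 * z)"
    using z w by (intro mult_right_mono mult_left_mono) auto
  finally have prod: "1 \<le> (1 - z) * (1 - w) * (1 + 2 * z)" .
  have pos: "0 < (1 - z) * (1 - w)" using z w by (intro mult_pos_pos) auto
  have Ly: "L - y > 0" "ln (real M) > 0" "L - y = L * (1 - z)"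
    using z L M by (auto simp: z_def field_simps)
  have "ln (real k) \<le> L" using M by (auto simp: L_def x_def n_def)
  have "R k \<le> R M / ln (real M) * ln (real k)"
    using M n by (intro R_ratio_le dominant) (auto simp: n_def)
  also have "\<dots> \<le> R M / (L - y) * L"
    using M Ly L R_pos[of M] \<open>ln (real k) \<le> L\<close> by (intro mult_mono divide_left_mono) (auto simp: n_def)
  also have "\<dots> = R M / (1 - z)" using L by (simp add: Ly)
  finally have Rk: "R k \<le> R M / (1 - z)" .
  have fac: "x - x / L - 1 = x * (1 - w)" using x L by (simp add: w_def field_simps)
  then have xpos: "x * (1 - w) * R M > 0" using x z w R_pos[of M] by (intro mult_pos_pos) auto
  have "R (Suc k) - R k = R k / (real (lucky n) - 1)" by (simp add: R_Suc_add n_def)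
  also have "\<dots> \<le> (R M / (1 - z)) / (x * (1 - w) * R M)"
    using M(4) fac Rk xpos R_pos[of k] by (intro frac_le) (auto intro: less_imp_le)
  also have "\<dots> = 1 / ((1 - z) * (1 - w)) / x" using R_pos[of M] by simp
  also have "\<dots> \<le> (1 + 2 * z) / x"
    using prod pos x by (intro divide_right_mono) (auto simp: pos_divide_le_eq mult.commute)
  finally show ?thesis by (simp add: n_def x_def L_def y_def z_def)
qed

text \<open>The increment bound of \<open>R_Suc_le\<close> is the derivative of
  \<open>ln t + (ln (ln t))\<^sup>2\<close> at \<open>n\<close>; this derivative decreases, so the
  increments of that function dominate.\<close>

lemma R_le_ln_plus_square:
  assumes "16 \<le> ln (real n)"
  shows "R n \<le> ln (real n) + (ln (ln (real n)))\<^sup>2 + 8.5"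
  using assms
proof (induction n)
  case (Suc k)
  define x where "x = real (Suc k)"
  have x: "x \<ge> 512" using gt_512_of_ln_ge_7[of "Suc k"] Suc.prems by (simp add: x_def)
  have k: "real k \<ge> 511" "x = real k + 1" using x by (auto simp: x_def)
  show ?case
  proof (cases "16 \<le> ln (real k)")
    case True
    have "\<exists>t>real k. t < x \<and> (ln x + (ln (ln x))\<^sup>2) - (ln (real k) + (ln (ln (real k)))\<^sup>2)
        = (x - real k) * ((1 + 2 * (ln (ln t) / ln t)) / t)"
    proof (rule MVT2)
      fix t assume "real k \<le> t" "t \<le> x"
      then have "t \<ge> 64" using k by simp
      then have "ln t > 1" using exp_1_le_ln[of t] exp_1_ge by linarith
      then show "((\<lambda>t. ln t + (ln (ln t))\<^sup>2) has_real_derivative (1 + 2 * (ln (ln t) / ln t)) / t) (at t)"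
        using \<open>t \<ge> 64\<close> by (auto intro!: derivative_eq_intros simp: field_simps)
    qed (use k in auto)
    then obtain t where t: "t > real k" "t < x"
      "(ln x + (ln (ln x))\<^sup>2) - (ln (real k) + (ln (ln (real k)))\<^sup>2) = (1 + 2 * (ln (ln t) / ln t)) / t"
      using k by auto
    have "exp 1 \<le> ln t" using t k by (intro exp_1_le_ln) simp
    then have "ln (ln x) / ln x \<le> ln (ln t) / ln t"
      using t k by (intro ln_x_over_x_mono) auto
    moreover have "0 \<le> ln (ln x) / ln x" using Suc.prems by (intro divide_nonneg_nonneg) (auto simp: x_def)
    ultimately have "(1 + 2 * (ln (ln x) / ln x)) / x \<le> (1 + 2 * (ln (ln t) / ln t)) / t"
      using t k by (intro frac_le) auto
    moreover have "R (Suc k) - R k \<le> (1 + 2 * (ln (ln x) / ln x)) / x"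
      using R_Suc_le[OF Suc.prems] by (simp add: x_def)
    ultimately have "R (Suc k) - R k \<le> (ln x + (ln (ln x))\<^sup>2) - (ln (real k) + (ln (ln (real k)))\<^sup>2)"
      using t by simp
    then show ?thesis using Suc.IH[OF True] by (simp add: x_def)
  next
    case False
    \<comment> \<open>The start of the induction: \<open>ln x\<close> lies between 16 and 16.1, and
      \<open>R \<le> 2 * ln x\<close> suffices as
      \<open>16.1 \<le> 2.77\<^sup>2 + 8.5\<close>.\<close>
    have "ln x - ln (real k) \<le> (x - real k) / real k" using k by (intro ln_diff_le) auto
    also have "\<dots> \<le> 0.1" using k by (simp add: field_simps)
    finally have "ln x \<le> 16.1" using False by simp
    moreover have "ln (ln x) \<ge> 2.77" using ln_ge_of_power_2_le[of 4 "ln x"] Suc.prems by (simp add: x_def)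
    then have "(ln (ln x))\<^sup>2 \<ge> 2.77\<^sup>2" by (intro power_mono) auto
    moreover have "R (Suc k) \<le> 2 * ln x" using R_le_two_ln[of "Suc k"] x by (simp add: x_def)
    ultimately show ?thesis by (simp add: x_def power2_eq_square)
  qed
qed simp

section \<open>The second-order bound\<close>

text \<open>Indeed \<open>k \<le> lucky (m + 1) - 1 \<le> m * R m \<le> 2 * m * ln m \<le>
  m\<^sup>2\<close>. It turns \<open>ln k \<ge> 64\<close> into
  \<open>ln m \<ge> 32\<close>.\<close>

lemma half_ln_le_ln_last_lucky:
  assumes "64 \<le> m" "Suc k < lucky (Suc m)" "1 \<le> k"
  shows "ln (real k) / 2 \<le> ln (real m)"
proof -
  have "j < lucky j" if "m < j" for j using that by (intro less_lucky) simp
  then have "real (lucky (Suc m)) - 1 \<le> real m * R m"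
    using lucky_le_product[of "Suc m" m] assms by fastforce
  also have "\<dots> \<le> real m * (2 * ln (real m))"
    using assms by (intro mult_left_mono R_le_two_ln) auto
  also have "\<dots> \<le> real m * real m"
  proof (rule mult_left_mono)
    have "ln (real m) \<le> real m / 2.7" using assms by (intro ln_le_div_2_7) simp
    then show "2 * ln (real m) \<le> real m" by simp
  qed simp
  finally have "real k \<le> real m * real m" using assms(2) by linarith
  then have "ln (real k) \<le> ln (real m * real m)" using assms by (subst ln_le_cancel_iff) auto
  also have "\<dots> = ln (real m) + ln (real m)" using assms by (intro ln_mult_pos) auto
  finally show ?thesis by simp
qed

text \<open>The second summand of \<open>G\<close> integrates the loss caused by the difference between the upper bound
  for \<open>R m\<close> and \<open>ln m\<close>: the derivative of \<open>- (s ^ 3 + 3 * s\<^sup>2 + 14.5 * s + 14.5) * exp (- s)\<close> is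
  \<open>s * (s\<^sup>2 + 8.5) * exp (- s)\<close>.\<close>

definition G :: "real \<Rightarrow> real" where
  "G x = (ln (ln x))\<^sup>2 / 2 + (ln (ln x) ^ 3 + 3 * (ln (ln x))\<^sup>2 + 14.5 * ln (ln x) + 14.5) / ln x"

lemma has_real_derivative_G:
  assumes "ln x > 0" "x > 0"
  shows "(G has_real_derivative
    (ln (ln x) / ln x - ln (ln x) * ((ln (ln x))\<^sup>2 + 8.5) / (ln x)\<^sup>2) / x) (at x)"
  unfolding G_def using assms
  by (auto intro!: derivative_eq_intros simp: field_simps power2_eq_square power3_eq_cube)

text \<open>With \<open>a = (ln w)\<^sup>2 + 8.5\<close>, a difference of squares gives
  \<open>1 / w - a / w\<^sup>2 \<le> 1 / (w + a)\<close>; then \<open>ln w / (w + a)\<close> is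
  shown to decrease.\<close>

lemma G_density_le:
  fixes u w :: real
  assumes "32 \<le> u" "u \<le> w"
  shows "ln w / w - ln w * ((ln w)\<^sup>2 + 8.5) / w\<^sup>2 \<le> ln u / (u + (ln u)\<^sup>2 + 8.5)"
proof -
  define s t where "s = ln w" and "t = ln u"
  have t: "t \<ge> 3" using ln_ge_of_power_2_le[of 5 u] assms by (simp add: t_def)
  have s: "s \<ge> t" using assms by (simp add: s_def t_def)
  have pos: "w + s\<^sup>2 + 8.5 > 0" "u + t\<^sup>2 + 8.5 > 0" "w > 0" using assms by (auto intro!: add_pos_nonneg)
  have "s / w - s * (s\<^sup>2 + 8.5) / w\<^sup>2 = s * ((w - (s\<^sup>2 + 8.5)) / w\<^sup>2)"
    using pos by (simp add: field_simps power2_eq_square)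
  also have "\<dots> \<le> s * (1 / (w + s\<^sup>2 + 8.5))"
  proof (rule mult_left_mono)
    have "(w - (s\<^sup>2 + 8.5)) * (w + s\<^sup>2 + 8.5) = w\<^sup>2 - (s\<^sup>2 + 8.5)\<^sup>2"
      by (simp add: power2_eq_square algebra_simps)
    then have "(w - (s\<^sup>2 + 8.5)) * (w + s\<^sup>2 + 8.5) \<le> w\<^sup>2" by simp
    then show "(w - (s\<^sup>2 + 8.5)) / w\<^sup>2 \<le> 1 / (w + s\<^sup>2 + 8.5)"
      using pos by (simp add: divide_le_eq pos_le_divide_eq mult.commute)
  qed (use s t in auto)
  also have "\<dots> \<le> t / (u + t\<^sup>2 + 8.5)"
  proof -
    have "exp 1 \<le> u" using e_less_272 assms by linarith
    then have "s / w \<le> t / u" unfolding s_def t_def using assms by (intro ln_x_over_x_mono)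
    then have "s * u \<le> t * w" using assms pos by (simp add: field_simps)
    \<comment> \<open>Since \<open>9 > 8.5\<close>, the quotient
      \<open>s / (s\<^sup>2 + 8.5)\<close> decreases for \<open>s \<ge> 3\<close>, which is why
      \<open>u \<ge> 32\<close> is assumed.\<close>
    moreover have "t * s \<ge> 3 * 3" using t s by (intro mult_mono) auto
    then have "(s - t) * (t * s - 8.5) \<ge> 0" using s by (intro mult_nonneg_nonneg) auto
    then have "s * t\<^sup>2 + 8.5 * s \<le> t * s\<^sup>2 + 8.5 * t"
      by (simp add: power2_eq_square field_simps)
    ultimately have "s * (u + t\<^sup>2 + 8.5) \<le> t * (w + s\<^sup>2 + 8.5)" by (simp add: distrib_left)
    then show ?thesis using pos by (simp add: pos_divide_le_eq pos_le_divide_eq)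
  qed
  finally show ?thesis by (simp add: s_def t_def)
qed

lemma R_Suc_ge_G:
  assumes "64 \<le> ln (real k)"
  shows "(ln (real (Suc k)) + G (Suc k)) - (ln (real k) + G k) \<le> R (Suc k) - R k"
proof -
  have k: "real k > 512" using gt_512_of_ln_ge_7[of k] assms by simp
  then obtain m where m: "1 \<le> m" "m < Suc k" "lucky m \<le> Suc k" "\<And>j. m < j \<Longrightarrow> Suc k < lucky j"
    using last_lucky_le[of "Suc k"] by auto
  have m64: "m \<ge> 64"
  proof (rule ccontr)
    assume "\<not> 64 \<le> m"
    then show False using m(4)[of 64] k by (simp add: lucky_17_upto_64)
  qed
  define u where "u = ln (real m)"
  have u: "u \<ge> 32" using half_ln_le_ln_last_lucky[OF m64, of k] m(4)[of "Suc m"] k assms by (simp add: u_def)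
  show ?thesis
  proof (rule R_gain)
    fix x assume "real k \<le> x"
    then have x: "x > 512" using k by linarith
    have "ln x > 1" using exp_1_le_ln[of x] exp_1_ge x by linarith
    then show "(G has_real_derivative
        (ln (ln x) / ln x - ln (ln x) * ((ln (ln x))\<^sup>2 + 8.5) / (ln x)\<^sup>2) / x) (at x)"
      using x by (intro has_real_derivative_G) auto
  next
    fix x assume x: "real k < x"
    have ux: "u \<le> ln x" using m64 m x by (simp add: u_def)
    have "x * ((ln (ln x) / ln x - ln (ln x) * ((ln (ln x))\<^sup>2 + 8.5) / (ln x)\<^sup>2) / x)
        = ln (ln x) / ln x - ln (ln x) * ((ln (ln x))\<^sup>2 + 8.5) / (ln x)\<^sup>2"
      using x k by simp
    also have "\<dots> \<le> ln u / (u + (ln u)\<^sup>2 + 8.5)" using u ux by (rule G_density_le)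
    also have "\<dots> \<le> ln u / R m"
    proof (rule divide_left_mono)
      show "R m \<le> u + (ln u)\<^sup>2 + 8.5" using R_le_ln_plus_square[of m] u by (simp add: u_def)
      then show "0 < (u + (ln u)\<^sup>2 + 8.5) * R m" using R_pos[of m] by (intro mult_pos_pos) linarith+
    qed (use u in simp)
    finally show "x * ((ln (ln x) / ln x - ln (ln x) * ((ln (ln x))\<^sup>2 + 8.5) / (ln x)\<^sup>2) / x)
        \<le> ln (ln (real m)) / R m" by (simp add: u_def)
  qed (use m m64 dominant in auto)
qed

text \<open>By \<open>R_Suc_ge_G\<close>, \<open>R n - ln n - G n\<close> does not decrease once
  \<open>ln n \<ge> 64\<close>. Its value at \<open>N\<close>, the first integer from
  \<open>exp 64\<close> on, is bounded below by \<open>R_ge_quarter\<close>.\<close>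

lemma R_ge_half:
  assumes "64 \<le> ln (real n)"
  shows "R n \<ge> ln (real n) + (ln (ln (real n)))\<^sup>2 / 2 - 4.7"
proof -
  define N where "N = nat \<lceil>exp (64::real)\<rceil>"
  have "exp (64::real) > 0" by simp
  then have N: "real N \<ge> exp 64" "real N \<le> exp 64 + 1" unfolding N_def by linarith+
  have "real N > 0" using N(1) exp_gt_zero[of "64::real"] by linarith
  then have lnN64: "ln (real N) \<ge> 64" using N by (simp add: ln_ge_iff)
  have npos: "real n > 0" using assms by (cases "n = 0") auto
  then have "real n \<ge> exp 64" using assms by (simp add: ln_ge_iff)
  then have nN: "N \<le> n" unfolding N_def by linarith
  have "exp (64::real) + 1 \<le> exp 64 * exp 1"
  proof -
    have "exp (64::real) * 2 \<le> exp 64 * exp 1" using exp_1_ge by (intro mult_left_mono) auto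
    moreover have "exp (64::real) \<ge> 1" by simp
    ultimately show ?thesis by linarith
  qed
  also have "\<dots> = exp 65" by (simp flip: exp_add)
  finally have "real N \<le> exp 65" using N by linarith
  then have "ln (real N) \<le> ln (exp 65)" using \<open>real N > 0\<close> by (subst ln_le_cancel_iff) auto
  then have lnN65: "ln (real N) \<le> 65" by simp
  define L s where "L = ln (real N)" and "s = ln L"
  have L: "64 \<le> L" "L \<le> 65" using lnN64 lnN65 by (simp_all add: L_def)
  have "ln L - ln 64 \<le> (L - 64) / 64" using L by (intro ln_diff_le) auto
  moreover have "ln (64::real) \<le> 25/6" using ln_le_of_le_power_2[of 64 6] by simp
  ultimately have s: "s \<le> 4.19" using L by (simp add: s_def)
  have s0: "s \<ge> 0" using L by (simp add: s_def)
  have "N \<ge> 64" using gt_512_of_ln_ge_7[of N] lnN64 by simp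
  then have RN: "R N \<ge> L + 2.9 + s\<^sup>2 / 4"
    unfolding L_def s_def by (intro R_ge_quarter dominant) auto
  have sq: "s\<^sup>2 \<le> 4.19\<^sup>2" "s ^ 3 \<le> 4.19 ^ 3"
    using power_mono[OF s s0, of 2] power_mono[OF s s0, of 3] .
  have "(s ^ 3 + 3 * s\<^sup>2 + 14.5 * s + 14.5) / L \<le> (4.19 ^ 3 + 3 * 4.19\<^sup>2 + 14.5 * 4.19 + 14.5) / 64"
    using sq s s0 L by (intro frac_le add_mono mult_left_mono) auto
  also have "\<dots> \<le> 3.2" by (simp add: eval_nat_numeral)
  \<comment> \<open>As \<open>G N \<le> s\<^sup>2 / 2 + 3.2\<close>, this needs only
    \<open>s\<^sup>2 / 4 \<le> 2.9 - 3.2 + 4.7 = 4.4\<close>, which holds for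
    \<open>s \<le> 4.19\<close>.\<close>
  finally have start: "R N \<ge> L + G N - 4.7"
    using RN sq(1) unfolding G_def L_def[symmetric] s_def[symmetric]
    by (simp only: power2_eq_square)
  have "R n \<ge> ln (real n) + G n - 4.7"
    using nN
  proof (induction rule: dec_induct)
    case (step k)
    have "ln (real N) \<le> ln (real k)" using step \<open>real N > 0\<close> by (subst ln_le_cancel_iff) auto
    then have "64 \<le> ln (real k)" using lnN64 by linarith
    then show ?case using R_Suc_ge_G[of k] step by linarith
  qed (use start in \<open>simp add: L_def\<close>)
  moreover have "G n \<ge> (ln (ln (real n)))\<^sup>2 / 2"
    unfolding G_def using assms by (auto intro!: divide_nonneg_nonneg add_nonneg_nonneg)
  ultimately show ?thesis by linarith
qed

lemma lucky_gt_second_order: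
  assumes "128 \<le> ln (real n)"
  shows "real (lucky n) > real n * (ln (real n) + 1 / 2 * (ln (ln (real n)))\<^sup>2 - ln (ln (real n)) - 7.207)"
proof -
  define x L y where "x = real n" and "L = ln x" and "y = ln L"
  have L: "L \<ge> 128" using assms by (simp add: x_def L_def)
  have x: "x \<ge> 512" using gt_512_of_ln_ge_7[of n] assms by (simp add: x_def)
  obtain M where M: "64 \<le> M" "M < n" "ln (real M) \<ge> L - y"
    "real (lucky n) - 1 \<ge> (x - x / L - 1) * R M"
    using lucky_ge_div_ln[of n] x by (auto simp: x_def L_def y_def)
  have y1: "y \<ge> 1" using ln_ge_of_power_2_le[of 7 L] L by (simp add: y_def)
  have "y \<le> L / 2.7" unfolding y_def using L by (intro ln_le_div_2_7) simp
  then have "L - y \<ge> L * (17/27)" by (simp add: field_simps)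
  then have Ly: "L - y \<ge> L * 0.6" "L - y \<ge> 64" using L by linarith+
  have ysq: "y\<^sup>2 \<le> 0.55 * L"
  proof -
    \<comment> \<open>The linear bound, applied to the square root, bounds the square of the
      logarithm linearly in \<open>L\<close>.\<close>
    have "ln (sqrt L) \<le> sqrt L / 2.7" using L by (intro ln_le_div_2_7) simp
    then have "y \<le> 2 / 2.7 * sqrt L" using L by (simp add: ln_sqrt y_def)
    then have "y\<^sup>2 \<le> (2 / 2.7 * sqrt L)\<^sup>2" using y1 by (intro power_mono) auto
    also have "\<dots> = 4 / 7.29 * L" using L by (simp add: power_mult_distrib power2_eq_square)
    also have "\<dots> \<le> 0.55 * L" using L by (intro mult_right_mono) auto
    finally show ?thesis .
  qed
  define d where "d = y / (L - y)"
  have d: "0 \<le> d" "d \<le> 1" using \<open>y \<le> L / 2.7\<close> Ly y1 L by (auto simp: d_def divide_le_eq)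
  have "y * d = y\<^sup>2 / (L - y)" by (simp add: d_def power2_eq_square)
  also have "\<dots> \<le> (0.55 * L) / (L * 0.6)" using ysq Ly L by (intro frac_le) auto
  also have "\<dots> \<le> 1" using L by simp
  finally have yd: "y * d \<le> 1" .
  \<comment> \<open>Replacing \<open>L\<close> by \<open>L - y\<close> lowers the logarithm by at
    most \<open>d\<close>; because \<open>y * d \<le> 1\<close>, its square drops by at most
    2.\<close>
  have "ln L - ln (L - y) \<le> (L - (L - y)) / (L - y)" using L Ly by (intro ln_diff_le) auto
  then have "y - d \<le> ln (L - y)" by (simp add: y_def d_def)
  then have "(y - d)\<^sup>2 \<le> (ln (L - y))\<^sup>2" using d y1 by (intro power_mono) auto
  moreover have "(y - d)\<^sup>2 = y\<^sup>2 - 2 * (y * d) + d\<^sup>2" by (simp add: power2_diff)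
  ultimately have lnsq: "y\<^sup>2 - 2 \<le> (ln (L - y))\<^sup>2" using yd zero_le_power2[of d] by linarith
  have "(ln (L - y))\<^sup>2 \<le> (ln (ln (real M)))\<^sup>2" using M Ly by (intro power_mono) auto
  moreover have "R M \<ge> ln (real M) + (ln (ln (real M)))\<^sup>2 / 2 - 4.7" using M Ly by (intro R_ge_half) linarith
  ultimately have RM: "L - y + y\<^sup>2 / 2 - 5.7 \<le> R M" using lnsq M by linarith
  define A where "A = L - y + y\<^sup>2 / 2 - 5.7"
  have A: "A \<le> 1.275 * L" "A \<ge> 0" using ysq y1 Ly L by (simp_all add: A_def) (smt (verit) zero_le_power2)
  have "x / L \<le> x / 128" using L x by (intro divide_left_mono) auto
  then have pos: "x - x / L - 1 \<ge> 0" using x by linarith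
  have "x / L * A \<le> x / L * (1.275 * L)" using A x L by (intro mult_left_mono) auto
  also have "\<dots> = 1.275 * x" using L by simp
  finally have xA: "x / L * A \<le> 1.275 * x" .
  have "L \<le> x / 64" unfolding L_def using x by (rule ln_le_div_64)
  \<comment> \<open>The loss is at most \<open>1.275 * x + 1.275 * L\<close>, and
    \<open>L \<le> x / 64\<close> keeps it below \<open>1.3 * x\<close>. The constants total
    \<open>5.7 + 1.3 = 7 < 7.207\<close>.\<close>
  have "x * (A - 1.3) \<le> x * A - x / L * A - A"
    using xA A(1) \<open>L \<le> x / 64\<close> x by (simp add: right_diff_distrib)
  also have "\<dots> = (x - x / L - 1) * A" by (simp add: algebra_simps)
  also have "\<dots> \<le> (x - x / L - 1) * R M" using RM pos by (intro mult_left_mono) (simp_all add: A_def)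
  finally have "x * (A - 1.3) < real (lucky n)" using M by linarith
  moreover have "x * (L + 1 / 2 * y\<^sup>2 - y - 7.207) \<le> x * (A - 1.3)"
    using x by (intro mult_left_mono) (simp_all add: A_def)
  ultimately show ?thesis by (simp add: x_def L_def y_def)
qed

theorem theorem1p1:
  "(\<forall>n::nat. n \<ge> 1 \<longrightarrow> real (lucky n) > real n * ln (real n)) \<and>
   (\<forall>n::nat. real n > exp (exp 4.927) \<longrightarrow>
      real (lucky n) > real n * (ln (real n) + 1 / 2 * (ln (ln (real n)))\<^sup>2 - ln (ln (real n)) - 7.207))"
proof (intro conjI allI impI)
  fix n :: nat assume "n \<ge> 1"
  then show "real (lucky n) > real n * ln (real n)" using dominant[of n] by (simp add: dominant_def)
next
  fix n :: nat assume n: "real n > exp (exp 4.927)"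
  \<comment> \<open>The hypothesis on \<open>n\<close> thus implies
    \<open>ln n \<ge> 128\<close>.\<close>
  have "ln (128::real) \<le> 4.927" using ln_le_of_le_power_2[of 128 7] by simp
  then have "exp (ln 128) \<le> exp (4.927::real)" by (subst exp_le_cancel_iff)
  then have "(128::real) \<le> exp 4.927" by simp
  moreover have "exp 4.927 \<le> ln (real n)"
    using n less_trans[OF exp_gt_zero n] by (subst ln_ge_iff) simp_all
  ultimately show "real (lucky n) > real n * (ln (real n) + 1 / 2 * (ln (ln (real n)))\<^sup>2
      - ln (ln (real n)) - 7.207)"
    by (intro lucky_gt_second_order) linarith
qed

end
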